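(* There exists an entire function $f:\mathbb{C}\to\mathbb{C}$ without zeros for which the Newton function $N_f(z)=z-\dfrac{f(z)}{f'(z)}$ is a transcendental meromorphic function (on $\mathbb{C}$) without invariant Baker domains.
   Context: For a nonconstant entire function $f$, the associated Newton function is the meromorphic function $N_f(z):=z-f(z)/f'(z)$. A meromorphic function on $\mathbb{C}$ is transcendental if it is not rational. For a transcendental meromorphic function $F:\mathbb{C}\to\widehat{\mathbb{C}}=\mathbb{C}\cup\{\infty\}$, with iterates $F^k$, the Fatou set of $F$ is the set of all points having a neighborhood in which all iterates $F^k$, $k\in\mathbb{N}$, are defined and form a normal family (with respect to the spherical metric). A component $U$ of the Fatou set is called invariant if $F(U)\subset U$. An invariant Baker domain of $F$ is an invariant component $U$ of the Fatou set of $F$ in which $F^k(z)\to\infty$ as $k\to\infty$ (for $z\in U$). *)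

theory Defs
  imports "HOL-Complex_Analysis.Complex_Analysis"
begin

section \<open>The Riemann sphere with the spherical metric\<close>

datatype riemann_sphere = Cpx complex | Infty

text \<open>Inverse stereographic projection onto the unit sphere of \<open>complex \<times> real\<close>.\<close>

fun sphere_point :: "riemann_sphere \<Rightarrow> complex \<times> real" where
  "sphere_point (Cpx z) =
     ((2 / (1 + (cmod z)\<^sup>2)) *\<^sub>R z, ((cmod z)\<^sup>2 - 1) / ((cmod z)\<^sup>2 + 1))"
| "sphere_point Infty = (0, 1)"

lemma inner_sphere_point_self: "sphere_point x \<bullet> sphere_point x = 1"
proof (cases x)
  case (Cpx z)
  define t where "t = (cmod z)\<^sup>2"
  have t: "t \<ge> 0" by (simp add: t_def)
  have zz: "z \<bullet> z = t" by (simp add: t_def dot_square_norm)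
  have "sphere_point x \<bullet> sphere_point x = (2 / (1 + t))\<^sup>2 * t + ((t - 1) / (t + 1))\<^sup>2"
    by (simp add: Cpx zz flip: t_def) (simp add: power2_eq_square)
  also have "\<dots> = (4 * t + (t - 1)\<^sup>2) / (1 + t)\<^sup>2"
    by (simp add: power_divide add_divide_distrib add.commute)
  also have "4 * t + (t - 1)\<^sup>2 = (1 + t)\<^sup>2" by algebra
  finally show ?thesis using t by simp
qed simp

lemma norm_sphere_point [simp]: "norm (sphere_point x) = 1"
  by (simp add: norm_eq_sqrt_inner inner_sphere_point_self)

lemma inj_sphere_point: "inj sphere_point"
proof (rule injI)
  have gt: "1 + (cmod z)\<^sup>2 > 0" for z
    by (smt (verit) zero_le_power2)
  have snd_Cpx: "snd (sphere_point (Cpx z)) = 1 - 2 / (1 + (cmod z)\<^sup>2)" for z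
    using gt[of z] by (simp add: field_simps)
  fix x y assume eq: "sphere_point x = sphere_point y"
  show "x = y"
  proof (cases x)
    case x: (Cpx z)
    show ?thesis
    proof (cases y)
      case y: (Cpx w)
      have "1 - 2 / (1 + (cmod z)\<^sup>2) = 1 - 2 / (1 + (cmod w)\<^sup>2)"
        using eq x y snd_Cpx by metis
      hence n: "(cmod z)\<^sup>2 = (cmod w)\<^sup>2"
        using gt[of z] gt[of w] by (simp add: field_simps)
      have "(2 / (1 + (cmod z)\<^sup>2)) *\<^sub>R z = (2 / (1 + (cmod w)\<^sup>2)) *\<^sub>R w"
        using eq x y by simp
      hence "z = w" using n gt[of w] by simp
      thus ?thesis using x y by simp
    next
      case Infty
      have "1 - 2 / (1 + (cmod z)\<^sup>2) = 1" using eq x Infty snd_Cpx[of z] by simp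
      thus ?thesis using gt[of z] by simp
    qed
  next
    case x: Infty
    show ?thesis
    proof (cases y)
      case (Cpx w)
      have "1 - 2 / (1 + (cmod w)\<^sup>2) = 1" using eq x Cpx snd_Cpx[of w] by simp
      thus ?thesis using gt[of w] by simp
    qed (use x in simp)
  qed
qed

lemma arccos_inner_triangle:
  fixes u v w :: "'a::real_inner"
  assumes [simp]: "norm u = 1" "norm v = 1" "norm w = 1"
  shows "arccos (u \<bullet> w) \<le> arccos (u \<bullet> v) + arccos (v \<bullet> w)"
proof -
  have bnd: "-1 \<le> a \<bullet> b \<and> a \<bullet> b \<le> 1" if "norm a = 1" "norm b = 1" for a b :: 'a
    using Cauchy_Schwarz_ineq2[of a b] that by auto
  have one: "u \<bullet> u = 1" "v \<bullet> v = 1" "w \<bullet> w = 1"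
    by (simp_all add: dot_square_norm)
  define \<alpha> where "\<alpha> = arccos (u \<bullet> v)"
  define \<beta> where "\<beta> = arccos (v \<bullet> w)"
  have ca: "cos \<alpha> = u \<bullet> v" "0 \<le> \<alpha>" "\<alpha> \<le> pi"
    using bnd[of u v] by (auto simp: \<alpha>_def cos_arccos arccos_lbound arccos_ubound)
  have cb: "cos \<beta> = v \<bullet> w" "0 \<le> \<beta>" "\<beta> \<le> pi"
    using bnd[of v w] by (auto simp: \<beta>_def cos_arccos arccos_lbound arccos_ubound)
  show ?thesis
  proof (cases "\<alpha> + \<beta> \<ge> pi")
    case True
    thus ?thesis
      using bnd[of u w] arccos_ubound[of "u \<bullet> w"] by (auto simp: \<alpha>_def \<beta>_def)
  next
    case False
    define p where "p = u - (u \<bullet> v) *\<^sub>R v"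
    define q where "q = w - (v \<bullet> w) *\<^sub>R v"
    have "p \<bullet> p = 1 - (u \<bullet> v)\<^sup>2"
      by (simp add: p_def inner_diff_left inner_diff_right one inner_commute power2_eq_square)
    also have "\<dots> = (sin \<alpha>)\<^sup>2" using ca by (simp add: sin_squared_eq)
    finally have np: "norm p = sin \<alpha>"
      using ca sin_ge_zero[of \<alpha>] by (simp add: norm_eq_sqrt_inner)
    have "q \<bullet> q = 1 - (v \<bullet> w)\<^sup>2"
      by (simp add: q_def inner_diff_left inner_diff_right one inner_commute power2_eq_square)
    also have "\<dots> = (sin \<beta>)\<^sup>2" using cb by (simp add: sin_squared_eq)
    finally have nq: "norm q = sin \<beta>"
      using cb sin_ge_zero[of \<beta>] by (simp add: norm_eq_sqrt_inner)
    have "p \<bullet> q = u \<bullet> w - (u \<bullet> v) * (v \<bullet> w)"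
      by (simp add: p_def q_def inner_diff_left inner_diff_right one inner_commute)
    moreover have "\<bar>p \<bullet> q\<bar> \<le> sin \<alpha> * sin \<beta>"
      using Cauchy_Schwarz_ineq2[of p q] np nq by simp
    ultimately have "cos (\<alpha> + \<beta>) \<le> u \<bullet> w"
      using ca cb by (simp add: cos_add)
    hence "arccos (u \<bullet> w) \<le> arccos (cos (\<alpha> + \<beta>))"
      using bnd[of u w] by (intro arccos_le_arccos) auto
    also have "\<dots> = \<alpha> + \<beta>"
      using ca cb False by (intro arccos_cos) auto
    finally show ?thesis by (simp add: \<alpha>_def \<beta>_def)
  qed
qed

text \<open>
  The distance is the great-circle distance on the unit sphere, that is, the length metric
  of \<open>2 \<bar>dz\<bar> / (1 + \<bar>z\<bar>\<^sup>2)\<close>.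
\<close>

instantiation riemann_sphere :: metric_space
begin

definition dist_riemann_sphere :: "riemann_sphere \<Rightarrow> riemann_sphere \<Rightarrow> real" where
  "dist_riemann_sphere x y = arccos (sphere_point x \<bullet> sphere_point y)"

definition uniformity_riemann_sphere :: "(riemann_sphere \<times> riemann_sphere) filter" where
  "uniformity_riemann_sphere = (INF e\<in>{0<..}. principal {(x, y). dist x y < e})"

definition open_riemann_sphere :: "riemann_sphere set \<Rightarrow> bool" where
  "open_riemann_sphere U \<longleftrightarrow>
     (\<forall>x\<in>U. eventually (\<lambda>(x', y). x' = x \<longrightarrow> y \<in> U) uniformity)"

instance
proof
  fix x y z :: riemann_sphere
  show "dist x y = 0 \<longleftrightarrow> x = y"
  proof
    assume "dist x y = 0"
    moreover have "\<bar>sphere_point x \<bullet> sphere_point y\<bar> \<le> 1"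
      using Cauchy_Schwarz_ineq2[of "sphere_point x" "sphere_point y"] by simp
    ultimately have "sphere_point x \<bullet> sphere_point y = 1"
      unfolding dist_riemann_sphere_def by (metis cos_arccos_abs cos_zero)
    hence "(sphere_point x - sphere_point y) \<bullet> (sphere_point x - sphere_point y) = 0"
      by (simp add: inner_diff_left inner_diff_right inner_sphere_point_self inner_commute)
    thus "x = y" using inj_sphere_point by (simp add: inj_eq)
  qed (simp add: dist_riemann_sphere_def inner_sphere_point_self)
  show "dist x y \<le> dist x z + dist y z"
    unfolding dist_riemann_sphere_def
    using arccos_inner_triangle[of "sphere_point x" "sphere_point z" "sphere_point y"]
    by (simp add: inner_commute)
qed (simp_all add: uniformity_riemann_sphere_def open_riemann_sphere_def)

end

section \<open>Meromorphic functions as maps into the sphere\<close>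

text \<open>
  In the library, a meromorphic function is a function \<open>complex \<Rightarrow> complex\<close> with arbitrary
  values at its poles and removable singularities.  The following is its continuous
  extension to a map into the sphere.
\<close>

definition sphere_map :: "(complex \<Rightarrow> complex) \<Rightarrow> complex \<Rightarrow> riemann_sphere" where
  "sphere_map g z = (if is_pole g z then Infty else Cpx (remove_sings g z))"

definition meromorphic_map :: "(complex \<Rightarrow> riemann_sphere) \<Rightarrow> bool" where
  "meromorphic_map F \<longleftrightarrow> (\<exists>g. g meromorphic_on UNIV \<and> F = sphere_map g)"

definition rational_map :: "(complex \<Rightarrow> riemann_sphere) \<Rightarrow> bool" where
  "rational_map F \<longleftrightarrow> (\<exists>p q. q \<noteq> 0 \<and> F = sphere_map (\<lambda>z. poly p z / poly q z))"

definition transcendental_meromorphic :: "(complex \<Rightarrow> riemann_sphere) \<Rightarrow> bool" where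
  "transcendental_meromorphic F \<longleftrightarrow> meromorphic_map F \<and> \<not> rational_map F"

definition newton_function :: "(complex \<Rightarrow> complex) \<Rightarrow> complex \<Rightarrow> riemann_sphere" where
  "newton_function f = sphere_map (\<lambda>z. z - f z / deriv f z)"

section \<open>Iteration, Fatou set and Baker domains\<close>

text \<open>
  The iterate \<open>F\<^sup>k\<close> is defined at \<open>z\<close> if the orbit of \<open>z\<close> does not meet \<open>Infty\<close> before
  time \<open>k\<close>; the value \<open>Infty\<close> at time \<open>k\<close> itself is allowed.  Beyond that,
  \<open>iterate F k z\<close> is a dummy value, to be used only together with \<open>iterate_defined\<close>.
\<close>

primrec iterate :: "(complex \<Rightarrow> riemann_sphere) \<Rightarrow> nat \<Rightarrow> complex \<Rightarrow> riemann_sphere" where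
  "iterate F 0 z = Cpx z"
| "iterate F (Suc k) z = (case iterate F k z of Cpx w \<Rightarrow> F w | Infty \<Rightarrow> Infty)"

definition iterate_defined :: "(complex \<Rightarrow> riemann_sphere) \<Rightarrow> nat \<Rightarrow> complex \<Rightarrow> bool" where
  "iterate_defined F k z \<longleftrightarrow> (\<forall>j<k. iterate F j z \<noteq> Infty)"

definition normal_family_on :: "complex set \<Rightarrow> (complex \<Rightarrow> riemann_sphere) set \<Rightarrow> bool" where
  "normal_family_on V \<F> \<longleftrightarrow>
     (\<forall>s :: nat \<Rightarrow> complex \<Rightarrow> riemann_sphere. range s \<subseteq> \<F> \<longrightarrow>
       (\<exists>r g. strict_mono (r :: nat \<Rightarrow> nat) \<and>
         (\<forall>K. compact K \<longrightarrow> K \<subseteq> V \<longrightarrow> uniform_limit K (s \<circ> r) g sequentially)))"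

definition fatou_set :: "(complex \<Rightarrow> riemann_sphere) \<Rightarrow> complex set" where
  "fatou_set F =
     {z. \<exists>V. open V \<and> z \<in> V \<and> (\<forall>k. \<forall>w\<in>V. iterate_defined F k w) \<and>
             normal_family_on V (range (iterate F))}"

definition invariant_fatou_component ::
    "(complex \<Rightarrow> riemann_sphere) \<Rightarrow> complex set \<Rightarrow> bool" where
  "invariant_fatou_component F U \<longleftrightarrow> U \<in> components (fatou_set F) \<and> F ` U \<subseteq> Cpx ` U"

definition invariant_baker_domain ::
    "(complex \<Rightarrow> riemann_sphere) \<Rightarrow> complex set \<Rightarrow> bool" where
  "invariant_baker_domain F U \<longleftrightarrow>
     invariant_fatou_component F U \<and> (\<forall>z\<in>U. (\<lambda>k. iterate F k z) \<longlonglongrightarrow> Infty)"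

end

theory Submission
  imports Defs
begin

text \<open>
  With \<open>f = exp \<circ> g\<close> the Newton function is \<open>N z = z - 1 / h z\<close>, where \<open>h = g'\<close> can be any entire function.
  Take \<open>h z = (\<Prod>n. 1 - (z / 2 ^ n) ^ k n)\<close> with \<open>k n\<close> growing so fast that on the circle of radius \<open>2 ^ n\<close>
  the gap between neighbouring zeros of \<open>h\<close> is small compared with \<open>1 / \<bar>h\<bar>\<close>, the step length of \<open>N\<close>.

  In an invariant Baker domain \<open>U\<close> join \<open>z\<^sub>0\<close> to \<open>N z\<^sub>0\<close> by a path. As the orbit of \<open>z\<^sub>0\<close> escapes, for all large
  \<open>n\<close> some iterate \<open>N\<^sup>j\<close> carries a point \<open>x\<close> of the path to a point of the circle of radius \<open>2 ^ n\<close>, which lies close to two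
  neighbouring zeros \<open>a\<close>, \<open>b\<close> of \<open>h\<close>. The zeros of \<open>h\<close> are poles of \<open>N\<close>, so
  \<open>\<phi> = (N\<^sup>j - a) / (b - a)\<close> omits 0 and 1 on \<open>U\<close>. But \<open>\<bar>\<phi> x\<bar> \<le> 1\<close> while
  \<open>\<bar>\<phi> (N x) - \<phi> x\<bar> \<ge> n\<close>, contradicting Schottky's theorem.
\<close>

section \<open>Schottky bounds for functions omitting 0 and 1\<close>

definition omit01 :: "complex set \<Rightarrow> (complex \<Rightarrow> complex) set" where
  "omit01 S = {f. f holomorphic_on S \<and> (\<forall>z\<in>S. f z \<noteq> 0 \<and> f z \<noteq> 1)}"

text \<open>One \<open>B\<close> serves the whole family. Phrased as a relation between points, so
  that local bounds can be chained.\<close>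

definition comparable :: "complex set \<Rightarrow> complex \<Rightarrow> complex \<Rightarrow> bool" where
  "comparable S x y \<longleftrightarrow> (\<forall>r. \<exists>B. \<forall>f\<in>omit01 S. cmod (f x) \<le> r \<longrightarrow> cmod (f y) \<le> B)"

text \<open>Schottky's theorem bounds \<open>f\<close> near the centre of a disc by its value there.
  Centring the disc at \<open>u\<close> instead of \<open>x\<close> compares any two points of the
  small ball.\<close>

lemma omit01_local_bound:
  assumes "open S" "x \<in> S"
  obtains \<delta> where "\<delta> > 0" "ball x \<delta> \<subseteq> S"
    "\<And>r. \<exists>B. \<forall>f\<in>omit01 S. \<forall>u\<in>ball x \<delta>. \<forall>v\<in>ball x \<delta>. cmod (f u) \<le> r \<longrightarrow> cmod (f v) \<le> B"
proof -
  obtain e where e: "e > 0" "cball x e \<subseteq> S"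
    using assms open_contains_cball_eq by blast
  define B where "B r = exp (pi * exp (pi * (2 + 2 * r + 12 * (1/2) / (1 - 1/2))))" for r
  have bound: "cmod (f v) \<le> B r"
    if f: "f \<in> omit01 S" and u: "u \<in> ball x (e/6)" and v: "v \<in> ball x (e/6)" and r: "cmod (f u) \<le> r" for f u v r
  proof -
    \<comment> \<open>As \<open>e/6 + 2*e/3 \<le> e\<close>, the disc of radius
      \<open>\<rho>\<close> about \<open>u\<close> stays in \<open>S\<close>. Points of the small
      ball are at most \<open>e/3 = \<rho>/2\<close> apart, whence the parameter 1/2 in
      \<open>B\<close>.\<close>
    define \<rho> where "\<rho> = 2*e/3"
    have \<rho>: "\<rho> > 0" using e by (simp add: \<rho>_def)
    define q where "q \<zeta> = u + of_real \<rho> * \<zeta>" for \<zeta> :: complex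
    have q_in: "q \<zeta> \<in> S" if "\<zeta> \<in> cball 0 1" for \<zeta>
    proof -
      have "dist x (q \<zeta>) \<le> dist x u + dist u (q \<zeta>)" by (rule dist_triangle)
      also have "dist u (q \<zeta>) = \<rho> * cmod \<zeta>"
        using \<rho> by (simp add: q_def dist_norm norm_mult)
      also have "\<dots> \<le> \<rho> * 1"
        using that \<rho> by (intro mult_left_mono) auto
      finally have "dist x (q \<zeta>) \<le> e"
        using u e by (auto simp: \<rho>_def)
      then show ?thesis using e by auto
    qed
    define \<zeta> where "\<zeta> = (v - u) / of_real \<rho>"
    have q0: "q 0 = u" by (simp add: q_def)
    have qv: "q \<zeta> = v" using \<rho> by (simp add: q_def \<zeta>_def)
    have "dist u v \<le> dist x u + dist x v"
      by (metis dist_commute dist_triangle)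
    then have "dist u v \<le> e/3"
      using u v by auto
    then have "cmod (v - u) \<le> e/3"
      by (simp add: dist_norm norm_minus_commute)
    then have "cmod (v - u) \<le> 1/2 * \<rho>" by (simp add: \<rho>_def)
    moreover have "cmod \<zeta> = cmod (v - u) / \<rho>"
      using \<rho> by (simp add: \<zeta>_def norm_divide)
    ultimately have \<zeta>: "cmod \<zeta> \<le> 1/2"
      using \<rho> pos_divide_le_eq by metis
    have "(f \<circ> q) holomorphic_on cball 0 1"
    proof (rule holomorphic_on_compose_gen)
      show "q holomorphic_on cball 0 1"
        unfolding q_def by (intro holomorphic_intros)
      show "f holomorphic_on S" using f by (simp add: omit01_def)
    qed (use q_in in auto)
    then have "cmod ((f \<circ> q) \<zeta>) \<le> B r"
      unfolding B_def
      using Schottky[of "f \<circ> q" r "1/2" \<zeta>] r \<zeta> q0 f q_in by (auto simp: omit01_def)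
    then show ?thesis by (simp add: qv)
  qed
  show ?thesis
  proof
    show "e/6 > 0" using e by simp
    show "ball x (e/6) \<subseteq> S" using e by (auto simp: subset_iff)
    show "\<exists>B. \<forall>f\<in>omit01 S. \<forall>u\<in>ball x (e/6). \<forall>v\<in>ball x (e/6). cmod (f u) \<le> r \<longrightarrow> cmod (f v) \<le> B" for r
      using bound by blast
  qed
qed

lemma comparable_trans: "comparable S x y \<Longrightarrow> comparable S y z \<Longrightarrow> comparable S x z"
  unfolding comparable_def by meson

lemma omit01_comparable:
  assumes S: "open S" "connected S" "x \<in> S" "y \<in> S"
  shows "comparable S x y"
proof -
  \<comment> \<open>\<open>connected_equivalence_relation\<close> asks for a symmetric relation,
    hence both directions at once.\<close>
  have "comparable S x y \<and> comparable S y x"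
  proof (rule connected_equivalence_relation[OF S(2-4)])
    fix x assume "x \<in> S"
    then obtain \<delta> where \<delta>: "\<delta> > 0" "ball x \<delta> \<subseteq> S"
      "\<And>r. \<exists>B. \<forall>f\<in>omit01 S. \<forall>u\<in>ball x \<delta>. \<forall>v\<in>ball x \<delta>. cmod (f u) \<le> r \<longrightarrow> cmod (f v) \<le> B"
      using omit01_local_bound S(1) by blast
    have "comparable S u v" if "u \<in> ball x \<delta>" "v \<in> ball x \<delta>" for u v
      unfolding comparable_def using \<delta>(3) that by meson
    then show "\<exists>T. openin (top_of_set S) T \<and> x \<in> T \<and> (\<forall>y\<in>T. comparable S x y \<and> comparable S y x)"
      using \<delta> S(1) by (intro exI[of _ "ball x \<delta>"]) (auto simp: openin_open_eq)
  qed (use comparable_trans in blast)+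
  then show ?thesis by simp
qed

section \<open>Unbounded orbits and crowded circles\<close>

text \<open>Separates the dynamics from sphere and normality: what is kept of a Baker domain is an
  invariant domain without zeros of \<open>h\<close> and an unbounded orbit in it.\<close>

lemma crowded_circles_no_escape:
  fixes h :: "complex \<Rightarrow> complex"
  defines "T \<equiv> \<lambda>z. z - 1 / h z"
  assumes U: "open U" "connected U" and h: "h holomorphic_on U" and nz: "\<And>z. z \<in> U \<Longrightarrow> h z \<noteq> 0"
    and T: "T ` U \<subseteq> U" and z0: "z0 \<in> U" and esc: "\<And>R. \<exists>k. cmod ((T ^^ k) z0) > R"
    and crowded: "\<And>n w. cmod w = 2 ^ n \<Longrightarrow>
      \<exists>a b. h a = 0 \<and> h b = 0 \<and> a \<noteq> b \<and> dist w a \<le> dist a b \<and> real n * cmod (h w) * dist a b \<le> 1"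
  shows False
proof -
  have TU: "(T ^^ j) z \<in> U" if "z \<in> U" for z j
    using that T by (induction j) auto
  have Thol: "(T ^^ j) holomorphic_on U" for j
  proof (induction j)
    case 0
    then show ?case by (simp add: id_def)
  next
    case (Suc j)
    have "T holomorphic_on U"
      unfolding T_def using h nz by (intro holomorphic_intros) auto
    then have "(T \<circ> (T ^^ j)) holomorphic_on U"
      using Suc TU by (intro holomorphic_on_compose_gen[where t = U]) auto
    then show ?case by (simp add: o_def)
  qed
  have Tcont: "continuous_on U (T ^^ j)" for j
    using Thol holomorphic_on_imp_continuous_on by blast
  have "path_connected U"
    using U connected_open_path_connected by blast
  moreover have "T z0 \<in> U" using T z0 by auto
  ultimately obtain \<gamma> where \<gamma>: "path \<gamma>" "path_image \<gamma> \<subseteq> U" "pathstart \<gamma> = z0" "pathfinish \<gamma> = T z0"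
    using z0 unfolding path_connected_def by blast
  obtain n0 where n0: "cmod z0 < 2 ^ n0"
    using real_arch_pow[of 2 "cmod z0"] by auto
  \<comment> \<open>\<open>T ^^ j\<close> carries the path to a curve joining consecutive orbit
    points. If none of these curves met the circle, the orbit would stay inside it, where
    \<open>z0\<close> lies as \<open>n \<ge> n0\<close>.\<close>
  have cross: "\<exists>x\<in>path_image \<gamma>. \<exists>j. cmod ((T ^^ j) x) = 2 ^ n" if "n \<ge> n0" for n
  proof (rule ccontr)
    assume contra: "\<not> ?thesis"
    have "cmod ((T ^^ j) z0) < 2 ^ n" for j
    proof (induction j)
      case 0
      have "(2::real) ^ n0 \<le> 2 ^ n" using that by (intro power_increasing) auto
      then show ?case using n0 by (simp del: power_increasing_iff)
    next
      case (Suc j)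
      show ?case
      proof (rule ccontr)
        assume *: "\<not> ?thesis"
        have "continuous_on {0..1} (\<lambda>t. cmod ((T ^^ j) (\<gamma> t)))"
        proof (intro continuous_on_norm continuous_on_compose2[OF Tcont])
          show "continuous_on {0..1} \<gamma>" using \<gamma> by (simp add: path_def)
          show "\<gamma> ` {0..1} \<subseteq> U" using \<gamma> by (simp add: path_image_def)
        qed
        moreover have "cmod ((T ^^ j) (\<gamma> 0)) \<le> 2 ^ n"
          using Suc \<gamma>(3) by (simp add: pathstart_def)
        moreover have "2 ^ n \<le> cmod ((T ^^ j) (\<gamma> 1))"
          using * \<gamma>(4) by (simp add: pathfinish_def funpow_swap1)
        ultimately obtain t where "0 \<le> t" "t \<le> 1" "cmod ((T ^^ j) (\<gamma> t)) = 2 ^ n"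
          using IVT'[of "\<lambda>t. cmod ((T ^^ j) (\<gamma> t))" 0 "2 ^ n" 1] by auto
        then show False using contra by (auto simp: path_image_def)
      qed
    qed
    then show False using esc[of "2 ^ n"] by (meson less_asym)
  qed
  then have "\<forall>n. \<exists>x j. x \<in> path_image \<gamma> \<and> cmod ((T ^^ j) x) = 2 ^ (n + n0)"
    by (metis le_add2)
  then obtain x j where x: "\<And>n. x n \<in> path_image \<gamma>" and j: "\<And>n. cmod ((T ^^ j n) (x n)) = 2 ^ (n + n0)"
    by metis
  \<comment> \<open>The crossing point varies with \<open>n\<close>; its limit point
    \<open>y\<close> lets the constants below be fixed before \<open>n\<close> is chosen.\<close>
  obtain y s where y: "y \<in> path_image \<gamma>" and s: "strict_mono s" and lim: "(x \<circ> s) \<longlonglongrightarrow> y"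
    using compact_path_image[OF \<gamma>(1)] x unfolding compact_def by metis
  have yU: "y \<in> U" "T y \<in> U" using y \<gamma>(2) T by auto
  obtain \<delta>1 where \<delta>1: "\<delta>1 > 0" 
      "\<And>r. \<exists>B. \<forall>f\<in>omit01 U. \<forall>u\<in>ball y \<delta>1. \<forall>v\<in>ball y \<delta>1. cmod (f u) \<le> r \<longrightarrow> cmod (f v) \<le> B"
    using omit01_local_bound[OF U(1) yU(1)] by metis
  obtain \<delta>2 where \<delta>2: "\<delta>2 > 0" 
      "\<And>r. \<exists>B. \<forall>f\<in>omit01 U. \<forall>u\<in>ball (T y) \<delta>2. \<forall>v\<in>ball (T y) \<delta>2. cmod (f u) \<le> r \<longrightarrow> cmod (f v) \<le> B"
    using omit01_local_bound[OF U(1) yU(2)] by metis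
  \<comment> \<open>The bounds pass from \<open>x m\<close> to \<open>y\<close>, then to
    \<open>T y\<close>, then to \<open>T (x m)\<close>.\<close>
  obtain B1 where B1: "\<And>f u v. \<lbrakk>f \<in> omit01 U; u \<in> ball y \<delta>1; v \<in> ball y \<delta>1; cmod (f u) \<le> 1\<rbrakk> \<Longrightarrow> cmod (f v) \<le> B1"
    using \<delta>1(2)[of 1] by blast
  obtain B2 where B2: "\<And>f. \<lbrakk>f \<in> omit01 U; cmod (f y) \<le> B1\<rbrakk> \<Longrightarrow> cmod (f (T y)) \<le> B2"
    using omit01_comparable[OF U yU] unfolding comparable_def by meson
  obtain B3 where B3: "\<And>f u v. \<lbrakk>f \<in> omit01 U; u \<in> ball (T y) \<delta>2; v \<in> ball (T y) \<delta>2; cmod (f u) \<le> B2\<rbrakk> \<Longrightarrow> cmod (f v) \<le> B3"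
    using \<delta>2(2)[of B2] by blast
  have "(\<lambda>n. T (x (s n))) \<longlonglongrightarrow> T y"
    using continuous_on_tendsto_compose[OF Tcont[of 1], of "x \<circ> s" y sequentially] lim yU(1) x \<gamma>(2)
    by (auto simp: o_def subset_iff)
  then have "\<forall>\<^sub>F n in sequentially. dist (T (x (s n))) (T y) < \<delta>2"
    using \<delta>2(1) by (rule tendstoD)
  moreover have "\<forall>\<^sub>F n in sequentially. dist ((x \<circ> s) n) y < \<delta>1"
    using lim \<delta>1(1) by (rule tendstoD)
  moreover have "\<forall>\<^sub>F n in sequentially. real n > B3 + 1"
    using eventually_gt_at_top[of "nat \<lceil>B3 + 1\<rceil>"] by eventually_elim linarith
  ultimately have "\<forall>\<^sub>F n in sequentially. dist (T (x (s n))) (T y) < \<delta>2 \<and> dist (x (s n)) y < \<delta>1 \<and> real n > B3 + 1"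
    by eventually_elim simp
  then obtain n where n: "dist (T (x (s n))) (T y) < \<delta>2" "dist (x (s n)) y < \<delta>1" "real n > B3 + 1"
    by (auto simp: eventually_sequentially)
  define m where "m = s n"
  have nm: "n \<le> m" unfolding m_def using s by (rule seq_suble)
  define w where "w = (T ^^ j m) (x m)"
  have xU: "x m \<in> U" using x \<gamma>(2) by auto
  have wU: "w \<in> U" unfolding w_def using TU[OF xU] .
  obtain a b where ab: "h a = 0" "h b = 0" "a \<noteq> b" "dist w a \<le> dist a b"
      "real (m + n0) * cmod (h w) * dist a b \<le> 1"
    using crowded[of w "m + n0"] j[of m] w_def by auto
  define f where "f z = ((T ^^ j m) z - a) / (b - a)" for z
  have f: "f \<in> omit01 U"
    unfolding omit01_def mem_Collect_eq
  proof (intro conjI ballI)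
    show "f holomorphic_on U"
      unfolding f_def using ab Thol by (intro holomorphic_intros) auto
  next
    fix z assume "z \<in> U"
    then have "h ((T ^^ j m) z) \<noteq> 0" using TU nz by blast
    then show "f z \<noteq> 0" "f z \<noteq> 1" using ab by (auto simp: f_def)
  qed
  have fx: "f (x m) = (w - a) / (b - a)" by (simp add: f_def w_def)
  have fTx: "f (T (x m)) = (T w - a) / (b - a)" by (simp add: f_def w_def funpow_swap1)
  have "cmod (f (x m)) \<le> 1"
    using ab(3,4) unfolding fx by (simp add: norm_divide dist_norm norm_minus_commute)
  then have "cmod (f y) \<le> B1"
    using B1[OF f, of "x m" y] n(2) \<delta>1(1) by (simp add: m_def dist_commute)
  then have "cmod (f (T y)) \<le> B2" using B2[OF f] by simp
  then have bound: "cmod (f (T (x m))) \<le> B3"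
    using B3[OF f, of "T y" "T (x m)"] n(1) \<delta>2(1) by (simp add: m_def dist_commute)
  \<comment> \<open>The step from \<open>w\<close> to \<open>T w\<close>, measured in units of the
    gap between \<open>a\<close> and \<open>b\<close>, will turn out to be at least
    \<open>m + n0\<close>, hence larger than \<open>1 + B3\<close>.\<close>
  have "f (x m) - f (T (x m)) = 1 / (h w * (b - a))"
  proof -
    have "f (x m) - f (T (x m)) = (w - T w) / (b - a)"
      unfolding fx fTx by (simp add: diff_divide_distrib)
    also have "w - T w = 1 / h w" by (simp add: T_def)
    finally show ?thesis by simp
  qed
  then have eq: "cmod (f (x m) - f (T (x m))) = 1 / (cmod (h w) * dist a b)"
    by (simp add: norm_divide norm_mult dist_norm norm_minus_commute)
  have pos: "cmod (h w) * dist a b > 0" using nz[OF wU] ab(3) by simp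
  have "real (m + n0) \<le> cmod (f (x m) - f (T (x m)))"
    unfolding eq using ab(5) pos by (simp add: divide_simps mult.assoc)
  also have "\<dots> \<le> cmod (f (x m)) + cmod (f (T (x m)))" by (rule norm_triangle_ineq4)
  finally have "real m \<le> 1 + B3" using bound \<open>cmod (f (x m)) \<le> 1\<close> by simp
  then show False using n(3) nm by simp
qed


section \<open>The entire function with crowded zeros\<close>

lemma dist_cis: "dist (cis s) (cis t) = 2 * \<bar>sin ((s - t) / 2)\<bar>"
proof -
  have "cis s - cis t = cis t * (exp (\<i> * of_real (s - t)) - 1)"
    by (simp add: cis_conv_exp ring_distribs flip: exp_add)
  then show ?thesis
    by (simp add: dist_norm norm_mult dist_exp_i_1 del: of_real_diff)
qed

text \<open>Rounding the argument of \<open>w\<close> down to a multiple of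
  \<open>2 * pi / k\<close> gives \<open>a\<close>, the next multiple gives \<open>b\<close>. The
  arc from \<open>a\<close> to \<open>w\<close> is at most one step, and chords grow with arcs up to
  a half turn; \<open>k \<ge> 2\<close> keeps the step in that range.\<close>

lemma adjacent_roots_near:
  fixes w :: complex and k :: nat
  assumes "cmod w = r" "r > 0" "k \<ge> 2"
  obtains a b where "(a / of_real r) ^ k = 1" "(b / of_real r) ^ k = 1" "a \<noteq> b"
    "dist w a \<le> dist a b" "dist a b \<le> 2 * pi * r / k"
proof -
  define \<theta> where "\<theta> = Arg w"
  have w: "w = of_real r * cis \<theta>"
    using assms by (metis \<theta>_def rcis_cmod_Arg rcis_def)
  define m :: int where "m = \<lfloor>\<theta> * k / (2 * pi)\<rfloor>"
  define s where "s i = 2 * pi * real_of_int i / k" for i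
  have root: "cis (s i) ^ k = 1" for i
  proof -
    have "real k * s i = 2 * pi * real_of_int i" using assms by (simp add: s_def)
    then show ?thesis by (simp only: Complex.DeMoivre cis_multiple_2pi Ints_of_int)
  qed
  have le: "s m \<le> \<theta>"
  proof -
    have "of_int m \<le> \<theta> * k / (2 * pi)" unfolding m_def by linarith
    then show ?thesis using assms by (simp add: s_def field_simps)
  qed
  have less: "\<theta> < s m + 2 * pi / k"
  proof -
    have "\<theta> * k / (2 * pi) < of_int m + 1" unfolding m_def by linarith
    then show ?thesis using assms by (simp add: s_def field_simps)
  qed
  have step: "s (m + 1) = s m + 2 * pi / k"
    by (simp add: s_def field_simps add_divide_distrib)
  have k: "pi / k \<le> pi / 2"
    using assms(3) by (intro divide_left_mono) auto
  have k_pos: "pi / k > 0"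
    using assms(3) by simp
  have sin_pos: "sin (pi / k) > 0"
    using k k_pos by (intro sin_gt_zero) (use pi_gt_zero in linarith)+
  have ab: "dist (cis (s m)) (cis (s (m + 1))) = 2 * sin (pi / k)"
    using sin_pos by (simp add: dist_cis step)
  have d: "0 \<le> (\<theta> - s m) / 2" "(\<theta> - s m) / 2 \<le> pi / k"
    using le less by (simp_all add: mult.commute)
  have "dist (cis \<theta>) (cis (s m)) = 2 * sin ((\<theta> - s m) / 2)"
    unfolding dist_cis using d k k_pos by (simp add: sin_ge_zero)
  also have "\<dots> \<le> 2 * sin (pi / k)"
    using d k k_pos by (intro mult_left_mono sin_monotone_2pi_le) auto
  finally have wa: "dist (cis \<theta>) (cis (s m)) \<le> dist (cis (s m)) (cis (s (m + 1)))"
    using ab by simp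
  have scale: "dist (of_real r * u) (of_real r * v) = r * dist u v" for u v :: complex
    using assms(2) by (simp add: dist_norm norm_mult flip: right_diff_distrib)
  show ?thesis
  proof (rule that[of "of_real r * cis (s m)" "of_real r * cis (s (m + 1))"])
    show "of_real r * cis (s m) \<noteq> of_real r * cis (s (m + 1))"
      using ab sin_pos assms(2) by auto
    show "dist w (of_real r * cis (s m)) \<le> dist (of_real r * cis (s m)) (of_real r * cis (s (m + 1)))"
      unfolding w scale using wa assms(2) by simp
    have "r * (2 * sin (pi / k)) \<le> r * (2 * (pi / k))"
      using k_pos assms(2) by (intro mult_left_mono sin_x_le_x) auto
    then show "dist (of_real r * cis (s m)) (of_real r * cis (s (m + 1))) \<le> 2 * pi * r / k"
      unfolding scale ab by (simp add: mult_ac)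
  qed (use root assms(2) in auto)
qed

text \<open>
  The product bounds the factors of index below \<open>n\<close> on the circle of radius \<open>2 ^ n\<close>. The constant 48 is
  \<open>(2 \<cdot> 3) \<cdot> (2 \<cdot> 4)\<close>: 2 bounds the \<open>n\<close>-th factor, \<open>3 \<ge> exp 1\<close> the later ones,
  and \<open>2 \<cdot> 4 \<ge> 2 \<cdot> pi\<close> comes from the gap \<open>2 \<cdot> pi \<cdot> 2 ^ n / crowding n\<close> between zeros.
\<close>
fun crowding :: "nat \<Rightarrow> nat" where
  "crowding n = 2 + 48 * n * 2 ^ n * (\<Prod>j<n. 1 + 2 ^ (n * crowding j))"

declare crowding.simps [simp del]

lemma crowding_ge_2: "crowding n \<ge> 2"
  by (subst crowding.simps) simp

definition crowded_factor :: "nat \<Rightarrow> complex \<Rightarrow> complex" where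
  "crowded_factor n z = - ((z / 2 ^ n) ^ crowding n)"

definition crowded_product :: "complex \<Rightarrow> complex" where
  "crowded_product z = lim (\<lambda>N. \<Prod>n<N. 1 + crowded_factor n z)"

text \<open>Once \<open>cmod z / 2 ^ n \<le> 1\<close>, the power \<open>crowding n \<ge> 1\<close>
  only shrinks it, so this geometric majorant holds however fast \<open>crowding\<close>
  grows.\<close>

lemma norm_crowded_factor_tail:
  assumes "cmod z \<le> 2 ^ m" "n \<ge> m"
  shows "cmod (crowded_factor n z) \<le> 2 ^ m * (1 / 2) ^ n"
proof -
  have q: "cmod z / 2 ^ n \<le> 2 ^ m * (1 / 2) ^ n"
    using assms(1) by (simp add: divide_simps)
  have "(2::real) ^ m \<le> 2 ^ n" using assms(2) by (intro power_increasing) auto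
  then have "cmod z \<le> 2 ^ n" using assms(1) by (rule order_trans[rotated])
  then have "cmod z / 2 ^ n \<le> 1" by simp
  then have "(cmod z / 2 ^ n) ^ crowding n \<le> (cmod z / 2 ^ n) ^ 1"
    using crowding_ge_2[of n] by (intro power_decreasing) auto
  then show ?thesis
    using q by (simp add: crowded_factor_def norm_power norm_divide)
qed

text \<open>The M-test with the geometric majorant gives uniform convergence of the sums of norms,
  hence of the products.\<close>

lemma crowded_product_uniform_limit:
  "uniform_limit (cball 0 R) (\<lambda>N z. \<Prod>n<N. 1 + crowded_factor n z) crowded_product sequentially"
proof -
  obtain m where m: "R < 2 ^ m" using real_arch_pow[of 2 R] by auto
  have "uniformly_convergent_on (cball 0 R) (\<lambda>N z. \<Sum>n<N. norm (crowded_factor n z))"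
  proof (rule Weierstrass_m_test'_ev)
    show "\<forall>\<^sub>F n in sequentially. \<forall>z\<in>cball 0 R. norm (norm (crowded_factor n z)) \<le> 2 ^ m * (1 / 2) ^ n"
      using eventually_ge_at_top[of m]
    proof eventually_elim
      case (elim n)
      then show ?case
        using norm_crowded_factor_tail[of _ m n] m by auto
    qed
    show "summable (\<lambda>n. 2 ^ m * (1 / 2) ^ n :: real)"
      by (intro summable_mult summable_geometric) simp
  qed
  then have "uniformly_convergent_on (cball 0 R) (\<lambda>N z. \<Prod>n<N. 1 + crowded_factor n z)"
    by (intro uniformly_convergent_on_prod)
       (auto simp: crowded_factor_def intro!: continuous_intros)
  then show ?thesis
    unfolding uniformly_convergent_uniform_limit_iff crowded_product_def .
qed

lemma crowded_product_LIMSEQ: "(\<lambda>N. \<Prod>n<N. 1 + crowded_factor n z) \<longlonglongrightarrow> crowded_product z"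
  by (rule tendsto_uniform_limitI[OF crowded_product_uniform_limit[of "cmod z"]]) simp

lemma crowded_product_holomorphic: "crowded_product holomorphic_on UNIV"
proof (rule holomorphic_uniform_sequence)
  show "(\<lambda>z. \<Prod>n<N. 1 + crowded_factor n z) holomorphic_on UNIV" for N
    unfolding crowded_factor_def by (intro holomorphic_intros) auto
  fix x :: complex
  have "cball x 1 \<subseteq> cball 0 (cmod x + 1)"
    by (simp add: cball_subset_cball_iff)
  then show "\<exists>d>0. cball x d \<subseteq> UNIV \<and>
      uniform_limit (cball x d) (\<lambda>N z. \<Prod>n<N. 1 + crowded_factor n z) crowded_product sequentially"
    using uniform_limit_on_subset[OF crowded_product_uniform_limit] by (intro exI[of _ 1]) auto
qed simp

lemma crowded_product_eq_0:
  assumes "(z / 2 ^ n) ^ crowding n = 1"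
  shows "crowded_product z = 0"
proof -
  have "\<forall>\<^sub>F N in sequentially. (\<Prod>n<N. 1 + crowded_factor n z) = 0"
    using eventually_gt_at_top[of n]
  proof eventually_elim
    case (elim N)
    have "1 + crowded_factor n z = 0" using assms by (simp add: crowded_factor_def)
    then show ?case using elim by (intro prod_zero) auto
  qed
  then have "(\<lambda>N. \<Prod>n<N. 1 + crowded_factor n z) \<longlonglongrightarrow> 0"
    by (rule tendsto_eventually)
  then show ?thesis using crowded_product_LIMSEQ LIMSEQ_unique by blast
qed

text \<open>Shows that \<open>h\<close> is not identically zero, which later isolates its zeros and
  makes \<open>f\<close> nonconstant.\<close>

lemma crowded_product_0: "crowded_product 0 = 1"
proof -
  have "crowded_factor n 0 = 0" for n
    using crowding_ge_2[of n] by (simp add: crowded_factor_def)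
  then have "(\<lambda>N. \<Prod>n<N. 1 + crowded_factor n 0) = (\<lambda>N. 1)" by simp
  then show ?thesis using crowded_product_LIMSEQ[of 0] by (simp add: LIMSEQ_const_iff)
qed

text \<open>On this circle factor \<open>n\<close> has modulus at most 2 and the later ones multiply
  to at most \<open>exp 1\<close>, whatever their exponents. Only \<open>crowding\<close> below
  \<open>n\<close> enters, so \<open>crowding n\<close> can be defined from this bound.\<close>

lemma norm_crowded_product_le:
  assumes w: "cmod w = 2 ^ n"
  shows "cmod (crowded_product w) \<le> 6 * (\<Prod>j<n. 1 + 2 ^ (n * crowding j))"
proof (rule Lim_norm_ubound[OF _ crowded_product_LIMSEQ])
  let ?P = "\<Prod>j<n. 1 + 2 ^ (n * crowding j) :: real"
  let ?f = "\<lambda>j. cmod (crowded_factor j w)"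
  show "\<forall>\<^sub>F N in sequentially. cmod (\<Prod>j<N. 1 + crowded_factor j w) \<le> 6 * ?P"
    using eventually_gt_at_top[of n]
  proof eventually_elim
    case (elim N)
    have "cmod (\<Prod>j<N. 1 + crowded_factor j w) = (\<Prod>j<N. cmod (1 + crowded_factor j w))"
      by (simp add: prod_norm)
    also have "\<dots> \<le> (\<Prod>j<N. 1 + ?f j)"
      by (intro prod_mono) (metis norm_ge_zero norm_one norm_triangle_ineq)
    also have "\<dots> = (\<Prod>j\<in>{..<n} \<union> ({n} \<union> {n<..<N}). 1 + ?f j)"
      using elim by (intro prod.cong) auto
    also have "\<dots> = (\<Prod>j<n. 1 + ?f j) * ((1 + ?f n) * (\<Prod>j\<in>{n<..<N}. 1 + ?f j))"
      by (subst prod.union_disjoint) auto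
    also have "\<dots> \<le> ?P * (2 * 3)"
    proof (intro mult_mono mult_nonneg_nonneg prod_nonneg)
      show "(\<Prod>j<n. 1 + ?f j) \<le> ?P"
      proof (intro prod_mono conjI add_left_mono)
        fix j
        have "(2::real) ^ n / 2 ^ j \<le> 2 ^ n" by (simp add: divide_simps)
        then have "((2::real) ^ n / 2 ^ j) ^ crowding j \<le> (2 ^ n) ^ crowding j"
          by (intro power_mono) auto
        then show "?f j \<le> 2 ^ (n * crowding j)"
          by (simp add: crowded_factor_def norm_power norm_divide w power_mult)
      qed auto
      show "1 + ?f n \<le> 2" by (simp add: crowded_factor_def norm_power norm_divide w)
      have "(\<Prod>j\<in>{n<..<N}. 1 + ?f j) \<le> exp (\<Sum>j\<in>{n<..<N}. ?f j)"
        by (intro prod_le_exp_sum) auto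
      also have "(\<Sum>j\<in>{n<..<N}. ?f j) \<le> (\<Sum>j\<in>{n<..<N}. 2 ^ n * (1 / 2) ^ j)"
        using w by (intro sum_mono norm_crowded_factor_tail) auto
      also have "\<dots> \<le> (1 :: real)"
      proof -
        have "(\<Sum>j\<in>{n<..<N}. (1 / 2) ^ j) \<le> ((1 / 2) ^ n :: real)"
        proof -
          \<comment> \<open>Telescoped form of the tail; \<open>M = N - Suc n\<close> recovers the
            range up to \<open>N\<close> because \<open>n < N\<close>.\<close>
          have "(\<Sum>j\<in>{n<..<n + Suc M}. (1 / 2) ^ j) = ((1 / 2) ^ n - (1 / 2) ^ (n + M) :: real)" for M
          proof (induction M)
            case 0
            have "{n<..<n + Suc 0} = {}" by auto
            then show ?case by simp
          next
            case (Suc M)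
            have "{n<..<n + Suc (Suc M)} = insert (n + Suc M) {n<..<n + Suc M}" by auto
            then show ?case using Suc by simp
          qed
          from this[of "N - Suc n"] show ?thesis using elim by simp
        qed
        then show ?thesis
          by (subst sum_distrib_left[symmetric]) (simp add: field_simps)
      qed
      finally show "(\<Prod>j\<in>{n<..<N}. 1 + ?f j) \<le> 3"
        using exp_le by (smt (verit) exp_le_cancel_iff)
    qed (auto intro!: prod_nonneg add_nonneg_nonneg)
    finally show ?case by simp
  qed
qed simp

lemma crowded_product_crowded:
  assumes w: "cmod w = 2 ^ n"
  shows "\<exists>a b. crowded_product a = 0 \<and> crowded_product b = 0 \<and> a \<noteq> b \<and>
    dist w a \<le> dist a b \<and> real n * cmod (crowded_product w) * dist a b \<le> 1"
proof -
  define k where "k = crowding n"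
  define P where "P = (\<Prod>j<n. 1 + 2 ^ (n * crowding j) :: real)"
  have P: "P \<ge> 0" unfolding P_def by (intro prod_nonneg) auto
  have k: "real k = 2 + 48 * real n * 2 ^ n * P"
    unfolding k_def P_def by (subst crowding.simps) simp
  have k2: "k \<ge> 2" by (simp add: k_def crowding_ge_2)
  obtain a b where ab: "(a / of_real (2 ^ n)) ^ k = 1" "(b / of_real (2 ^ n)) ^ k = 1" "a \<noteq> b"
      "dist w a \<le> dist a b" "dist a b \<le> 2 * pi * 2 ^ n / k"
    using adjacent_roots_near[OF w _ k2] by auto
  have "real n * cmod (crowded_product w) * dist a b \<le> real n * (6 * P) * (2 * 4 * 2 ^ n / k)"
  proof (intro mult_mono mult_left_mono)
    show "cmod (crowded_product w) \<le> 6 * P"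
      using norm_crowded_product_le[OF w] by (simp add: P_def)
    have "2 * pi * 2 ^ n / k \<le> 2 * 4 * 2 ^ n / k"
      using pi_less_4 by (intro divide_right_mono mult_right_mono) auto
    then show "dist a b \<le> 2 * 4 * 2 ^ n / k" using ab(5) by linarith
  qed (use P in auto)
  \<comment> \<open>The numerator \<open>48 * n * 2 ^ n * P\<close>, with
    \<open>48 = 6 * 2 * 4\<close>, is exactly \<open>k - 2\<close>; the summand 2 in
    \<open>crowding\<close> gives \<open>k \<ge> 2\<close> even at \<open>n = 0\<close>.\<close>
  also have "\<dots> = (real k - 2) / real k" by (simp add: k)
  also have "\<dots> \<le> 1" using k2 by simp
  finally show ?thesis
    using ab crowded_product_eq_0[of a n] crowded_product_eq_0[of b n] by (auto simp: k_def)
qed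

section \<open>Poles, the point at infinity and the conclusion\<close>

text \<open>At a zero of \<open>h\<close> the formula evaluates to \<open>z - 1 / 0 = z\<close>, so
  the pole is read off from the punctured limit: \<open>h c \<noteq> 0\<close> isolates the zeros of
  \<open>h\<close>, hence \<open>1 / h\<close> tends to infinity.\<close>

lemma is_pole_newton_at_zero:
  assumes h: "h holomorphic_on UNIV" "h c \<noteq> 0" and z: "h z = 0"
  shows "is_pole (\<lambda>z. z - 1 / h z) z"
proof -
  have "\<forall>\<^sub>F w in at z. h w \<noteq> 0"
    using non_zero_neighbour_alt[OF h(1), of z c] h(2) by (auto elim: eventually_mono)
  moreover have "h \<midarrow>z\<rightarrow> 0"
    using h(1) z by (metis holomorphic_on_imp_continuous_on continuous_on_eq_continuous_at isCont_def open_UNIV UNIV_I)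
  ultimately have "filterlim h (at 0) (at z)" by (simp add: filterlim_at)
  then have "filterlim (\<lambda>w. inverse (h w)) at_infinity (at z)"
    by (rule filterlim_compose[OF filterlim_inverse_at_infinity])
  then have "filterlim (\<lambda>w. - inverse (h w)) at_infinity (at z)"
    by (simp add: filterlim_at_infinity_conv_norm_at_top)
  then have "filterlim (\<lambda>w. w + - inverse (h w)) at_infinity (at z)"
    by (intro tendsto_add_filterlim_at_infinity[OF tendsto_ident_at])
  then show ?thesis by (simp add: is_pole_def divide_inverse)
qed

text \<open>The cosine of the distance to \<open>Infty\<close> is the height on the unit sphere;
  over the disc of radius \<open>R\<close> it stays below 1 by at least
  \<open>2 / (R\<^sup>2 + 1)\<close>.\<close>

lemma tendsto_Infty_unbounded:
  assumes "(\<lambda>k. Cpx (x k)) \<longlonglongrightarrow> Infty"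
  shows "\<exists>k. cmod (x k) > R"
proof (rule ccontr)
  assume "\<not> ?thesis"
  then have R: "cmod (x k) \<le> R" for k by (simp add: not_less)
  let ?c = "\<lambda>k. ((cmod (x k))\<^sup>2 - 1) / ((cmod (x k))\<^sup>2 + 1)"
  have c: "cos (dist (Cpx (x k)) Infty) = ?c k" for k
  proof -
    have "- 1 \<le> ?c k" "?c k \<le> 1"
      by (simp_all add: divide_simps add_nonneg_pos)
    then show ?thesis by (simp add: dist_riemann_sphere_def cos_arccos)
  qed
  have "(\<lambda>k. dist (Cpx (x k)) Infty) \<longlonglongrightarrow> 0"
    using assms by (rule iffD1[OF tendsto_dist_iff])
  then have "(\<lambda>k. cos (dist (Cpx (x k)) Infty)) \<longlonglongrightarrow> cos 0"
    by (intro tendsto_intros)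
  then have "?c \<longlonglongrightarrow> 1" by (simp add: c)
  moreover have "?c k \<le> 1 - 2 / (R\<^sup>2 + 1)" for k
  proof -
    have pos: "(cmod (x k))\<^sup>2 + 1 > 0" by (simp add: add_nonneg_pos)
    have "(cmod (x k))\<^sup>2 \<le> R\<^sup>2" using R[of k] by (intro power_mono) auto
    then have "2 / (R\<^sup>2 + 1) \<le> 2 / ((cmod (x k))\<^sup>2 + 1)"
      using pos by (intro divide_left_mono) auto
    also have "\<dots> = 1 - ?c k" using pos by (simp add: divide_simps)
    finally show ?thesis by simp
  qed
  ultimately have "1 \<le> 1 - 2 / (R\<^sup>2 + 1)"
    by (intro LIMSEQ_le_const2) auto
  moreover have "2 / (R\<^sup>2 + 1) > 0" by (simp add: add_nonneg_pos)
  ultimately show False by linarith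
qed

theorem theorem1:
  shows "\<exists>f :: complex \<Rightarrow> complex.
    f holomorphic_on UNIV \<and> \<not> f constant_on UNIV \<and> (\<forall>z. f z \<noteq> 0) \<and>
    transcendental_meromorphic (newton_function f) \<and>
    \<not> (\<exists>U. invariant_baker_domain (newton_function f) U)"
proof -
  define h where "h = crowded_product"
  have hol: "h holomorphic_on UNIV" and h0: "h 0 \<noteq> 0"
    by (simp_all add: h_def crowded_product_holomorphic crowded_product_0)
  obtain g where g: "\<And>z. (g has_field_derivative h z) (at z)"
    using holomorphic_convex_primitive'[of UNIV h] hol by auto
  define f where "f z = exp (g z)" for z
  have f': "(f has_field_derivative f z * h z) (at z)" for z
    unfolding f_def by (rule derivative_eq_intros g refl)+
  have f_nz: "f z \<noteq> 0" for z by (simp add: f_def)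
  have f_hol: "f holomorphic_on UNIV"
    using f' by (auto simp: holomorphic_on_def field_differentiable_def)
  have f_nc: "\<not> f constant_on UNIV"
  proof
    assume "f constant_on UNIV"
    then obtain c where "f = (\<lambda>_. c)" by (auto simp: constant_on_def)
    then have "(f has_field_derivative 0) (at 0)" by simp
    then show False using f'[of 0] f_nz h0 DERIV_unique by fastforce
  qed
  define N where "N z = z - 1 / h z" for z
  \<comment> \<open>Cancelling \<open>f z\<close> in \<open>f z / (f z * h z)\<close> leaves
    \<open>1 / h z\<close>; where \<open>h z = 0\<close> both quotients have the default value
    0.\<close>
  have newton: "newton_function f = sphere_map N"
    using f_nz by (simp add: newton_function_def DERIV_imp_deriv[OF f'] N_def[abs_def])
  have at_zero: "sphere_map N z = Infty" if "h z = 0" for z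
    using is_pole_newton_at_zero[OF hol h0 that] by (simp add: sphere_map_def N_def[abs_def])
  have at_nz: "sphere_map N z = Cpx (N z)" if "h z \<noteq> 0" for z
  proof -
    have "h analytic_on {z}" using hol analytic_on_open analytic_on_subset by blast
    then have "N analytic_on {z}"
      unfolding N_def[abs_def] using that by (intro analytic_intros) auto
    then show ?thesis by (simp add: sphere_map_def analytic_at_imp_no_pole)
  qed
  have "N meromorphic_on UNIV"
    unfolding N_def[abs_def]
    by (intro meromorphic_intros analytic_on_imp_meromorphic_on) (use hol analytic_on_open in auto)
  then have "meromorphic_map (sphere_map N)" by (auto simp: meromorphic_map_def)
  moreover have "\<not> rational_map (sphere_map N)"
  proof
    assume "rational_map (sphere_map N)"
    then obtain p q where q: "q \<noteq> 0" and eq: "sphere_map N = sphere_map (\<lambda>z. poly p z / poly q z)"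
      by (auto simp: rational_map_def)
    \<comment> \<open>A rational function has poles only at roots of \<open>q\<close>, but
      \<open>h\<close> vanishes at every \<open>2 ^ n\<close>.\<close>
    have "poly q z = 0" if "h z = 0" for z
    proof (rule ccontr)
      assume "poly q z \<noteq> 0"
      then have "(\<lambda>z. poly p z / poly q z) analytic_on {z}"
        by (intro analytic_on_divide holomorphic_on_imp_analytic_at[of _ UNIV] holomorphic_intros) auto
      then have "\<not> is_pole (\<lambda>z. poly p z / poly q z) z" by (rule analytic_at_imp_no_pole)
      then show False using fun_cong[OF eq, of z] at_zero[OF that] by (simp add: sphere_map_def)
    qed
    then have "range (\<lambda>n. 2 ^ n) \<subseteq> {z. poly q z = 0}"
      using crowded_product_eq_0[of "2 ^ n" n for n] by (auto simp: h_def)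
    then have "finite (range (\<lambda>n. 2 ^ n :: complex))"
      using poly_roots_finite[OF q] finite_subset by blast
    moreover have "inj (\<lambda>n::nat. 2 ^ n :: complex)"
    proof (rule injI)
      fix m n :: nat assume "(2::complex) ^ m = 2 ^ n"
      then have "cmod (2 ^ m) = cmod (2 ^ n)" by simp
      then show "m = n" by (simp add: norm_power)
    qed
    ultimately show False using finite_imageD infinite_UNIV_nat by blast
  qed
  moreover have False if "invariant_baker_domain (sphere_map N) U" for U
  proof -
    have comp: "U \<in> components (fatou_set (sphere_map N))" and inv: "sphere_map N ` U \<subseteq> Cpx ` U"
      and esc: "\<And>z. z \<in> U \<Longrightarrow> (\<lambda>k. iterate (sphere_map N) k z) \<longlonglongrightarrow> Infty"
      using that by (auto simp: invariant_baker_domain_def invariant_fatou_component_def)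
    have "open (fatou_set (sphere_map N))"
      unfolding open_subopen[of "fatou_set _"] by (auto simp: fatou_set_def) 
    then have U: "open U" "connected U" "U \<noteq> {}"
      using comp open_components in_components_connected in_components_nonempty by blast+
    obtain z0 where z0: "z0 \<in> U" using U by auto
    \<comment> \<open>\<open>inv\<close> keeps \<open>Infty\<close> out of the image of
      \<open>U\<close>, and zeros of \<open>h\<close> are sent there.\<close>
    have nz: "h z \<noteq> 0" if "z \<in> U" for z
      using that inv at_zero by fastforce
    have NU: "N ` U \<subseteq> U"
      using inv at_nz nz by (auto simp: image_subset_iff image_iff)
    have NkU: "(N ^^ k) z0 \<in> U" for k
      using NU z0 by (induction k) auto
    \<comment> \<open>The orbit never leaves \<open>U\<close>, so it never takes the
      \<open>Infty\<close> branch of \<open>iterate\<close>.\<close>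
    have it: "iterate (sphere_map N) k z0 = Cpx ((N ^^ k) z0)" for k
      by (induction k) (auto simp: at_nz nz NkU)
    have unbounded: "\<exists>k. cmod ((N ^^ k) z0) > R" for R
      using tendsto_Infty_unbounded[of "\<lambda>k. (N ^^ k) z0"] esc[OF z0] by (simp add: it)
    show False
      using crowded_circles_no_escape[OF U(1,2) holomorphic_on_subset[OF hol] nz _ z0, folded N_def[abs_def]]
        NU unbounded crowded_product_crowded by (simp add: h_def)
  qed
  ultimately show ?thesis
    unfolding transcendental_meromorphic_def newton[symmetric]
    using f_hol f_nc f_nz by blast
qed

end
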